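(* Let $G$ be a finite group and let $\alpha$ be an automorphism of $G$ such that $\lambda(\alpha)\geq\frac{1}{3}$. Then $\alpha$ has a regular cycle, i.e. a cycle whose length equals $\mathrm{ord}(\alpha)$.
   Context: For an automorphism $\alpha$ of a finite group $G$, $\lambda(\alpha)$ denotes the quotient of the largest cycle length of $\alpha$ (as a permutation of the underlying set of $G$) by $|G|$. A regular cycle of a permutation is a cycle whose length equals the order of the permutation. *)

theory Defs
  imports Complex_Main "HOL-Algebra.Bij" "HOL-Algebra.Multiplicative_Group" "HOL-Combinatorics.Orbits"
begin

text \<open>
  The cycles of a permutation \<open>f\<close> of \<open>S\<close>, as subsets of \<open>S\<close>. Fixed points are
  cycles of length 1. Only the values of \<open>f\<close> on \<open>S\<close> matter, so this applies to the
  extensional functions in \<open>Bij S\<close>.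
\<close>
definition cycles_on :: "'a set \<Rightarrow> ('a \<Rightarrow> 'a) \<Rightarrow> 'a set set" where
  "cycles_on S f = Orbits.orbit f ` S"

definition largest_cycle_length :: "'a set \<Rightarrow> ('a \<Rightarrow> 'a) \<Rightarrow> nat" where
  "largest_cycle_length S f = Max (card ` cycles_on S f)"

text \<open>The quantity $\lambda(\alpha)$.\<close>
definition cycle_ratio :: "('a, 'b) monoid_scheme \<Rightarrow> ('a \<Rightarrow> 'a) \<Rightarrow> real" where
  "cycle_ratio G \<alpha> = real (largest_cycle_length (carrier G) \<alpha>) / real (order G)"

definition regular_cycle :: "'a set \<Rightarrow> ('a \<Rightarrow> 'a) \<Rightarrow> 'a set \<Rightarrow> bool" where
  "regular_cycle S f C \<longleftrightarrow> C \<in> cycles_on S f \<and> card C = group.ord (BijGroup S) f"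

text \<open>The order as a permutation is the order in the automorphism group.\<close>
lemma (in group) ord_AutoGroup_eq:
  "group.ord (AutoGroup G) \<alpha> = group.ord (BijGroup (carrier G)) \<alpha>"
proof -
  have pow: "\<alpha> [^]\<^bsub>AutoGroup G\<^esub> n = \<alpha> [^]\<^bsub>BijGroup (carrier G)\<^esub> n" for n :: nat
    by (simp add: AutoGroup_def nat_pow_def)
  show ?thesis
    unfolding group.ord_def[OF AutoGroup] group.ord_def[OF group_BijGroup] pow
    by (simp add: AutoGroup_def)
qed

end

theory Submission
  imports Defs
begin

text \<open>
  Let \<open>C\<close> be a cycle of maximal length \<open>L\<close>, and put \<open>\<beta> = \<alpha>\<^sup>L\<close>, which fixes \<open>C\<close> pointwise. It
  suffices to show that \<open>\<beta>\<close> is the identity. Otherwise the fixed points of \<open>\<beta>\<close> form a proper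
  subgroup \<open>H\<close> containing both \<open>C\<close> and the identity, which forces \<open>H\<close> to have index 2 (unless
  \<open>L = 1\<close>). For \<open>y \<notin> H\<close> we have \<open>\<beta> y = y u\<close>, where \<open>u \<in> H\<close> commutes with \<open>H\<close>, hence is fixed
  by \<open>\<alpha>\<close>. Thus \<open>C u\<close> is again a cycle in \<open>H\<close>; since \<open>C\<close> fills more than half of \<open>H\<close>, it equals
  \<open>C\<close>, so some power of \<open>\<alpha>\<close> agrees with multiplication by \<open>u\<close> on \<open>C\<close>. Every element of \<open>H\<close> is a
  quotient of two elements of \<open>C\<close>, so this power is the identity on \<open>H\<close>. Hence \<open>u = 1\<close> and
  \<open>y \<in> H\<close>, a contradiction.
\<close>

section \<open>Orbits of permutations of a finite set\<close>

lemma orbit_conv_funpow_card: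
  assumes "x \<in> orbit f x"
  shows "(f ^^ card (orbit f x)) x = x"
proof -
  have "card (orbit f x) = funpow_dist1 f x x"
    using orbit_conv_funpow_dist1[OF assms] card_image[OF inj_on_funpow_dist1[OF assms]]
    by simp
  then show ?thesis
    using funpow_dist1_prop[OF assms] by simp
qed

text \<open>Not immediate, since \<open>orbit f x\<close> starts at \<open>f x\<close>. Extending
  \<open>f\<close> by the identity off \<open>S\<close> gives a genuine permutation with the same
  orbit.\<close>

lemma self_in_orbit_bij_betw:
  assumes "bij_betw f S S" "finite S" "x \<in> S"
  shows "x \<in> orbit f x"
proof -
  let ?p = "perm_restrict f S"
  have "bij_betw ?p S S"
    using assms(1) bij_betw_cong[of S ?p f S] by (simp add: perm_restrict_simps)
  then have "?p permutes S"
    by (rule bij_imp_permutes) (simp add: perm_restrict_simps)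
  then have "x \<in> orbit ?p x"
    using assms(2) by (metis permutation_permutes permutation_self_in_orbit)
  also have "orbit ?p x = orbit f x"
    using assms bij_betwE[OF assms(1)]
    by (intro orbit_cong0[of x S]) (auto simp: perm_restrict_simps)
  finally show ?thesis .
qed

lemma orbit_subset_funcset:
  assumes "f \<in> S \<rightarrow> S" "x \<in> S"
  shows "orbit f x \<subseteq> S"
proof
  fix y assume "y \<in> orbit f x"
  then show "y \<in> S" using assms by induct (blast intro: funcset_mem)+
qed

section \<open>Powers in \<open>BijGroup\<close> and the order of a permutation\<close>

lemma nat_pow_BijGroup:
  assumes "f \<in> Bij S" "x \<in> S"
  shows "(f [^]\<^bsub>BijGroup S\<^esub> (n::nat)) x = (f ^^ n) x"
proof -
  interpret B: group "BijGroup S" by (rule group_BijGroup)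
  have car: "carrier (BijGroup S) = Bij S" by (simp add: BijGroup_def)
  have mult: "g \<otimes>\<^bsub>BijGroup S\<^esub> f = compose S g f" if "g \<in> Bij S" for g
    using that assms(1) by (simp add: BijGroup_def)
  show ?thesis using assms(2)
  \<comment> \<open>The rightmost factor \<open>f\<close> acts first, so the induction hypothesis is
    needed at \<open>f x\<close>.\<close>
  proof (induction n arbitrary: x)
    case 0
    then show ?case by (simp add: BijGroup_def)
  next
    case (Suc n)
    have "f [^]\<^bsub>BijGroup S\<^esub> n \<in> Bij S"
      using B.nat_pow_closed[of f n] assms car by simp
    then have "(f [^]\<^bsub>BijGroup S\<^esub> Suc n) x = (f [^]\<^bsub>BijGroup S\<^esub> n) (f x)"
      using Suc.prems mult by (simp only: B.nat_pow_Suc compose_eq)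
    moreover have "f x \<in> S" using Bij_imp_funcset[OF assms(1)] Suc.prems by auto
    ultimately show ?case
      using Suc.IH[of "f x"] by (simp only: funpow_Suc_right o_apply)
  qed
qed

lemma nat_pow_BijGroup_eq_one_iff:
  fixes f :: "'a \<Rightarrow> 'a"
  assumes "f \<in> Bij S"
  shows "f [^]\<^bsub>BijGroup S\<^esub> (n::nat) = \<one>\<^bsub>BijGroup S\<^esub> \<longleftrightarrow> (\<forall>x\<in>S. (f ^^ n) x = x)"
proof -
  interpret B: group "BijGroup S" by (rule group_BijGroup)
  have car: "carrier (BijGroup S) = Bij S" and one: "\<one>\<^bsub>BijGroup S\<^esub> = (\<lambda>x\<in>S. x)"
    by (simp_all add: BijGroup_def)
  have "f [^]\<^bsub>BijGroup S\<^esub> n \<in> Bij S"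
    using B.nat_pow_closed[of f n] assms unfolding car .
  then have "f [^]\<^bsub>BijGroup S\<^esub> n \<in> extensional S" by (rule Bij_imp_extensional)
  moreover have "g = (\<lambda>x\<in>S. x) \<longleftrightarrow> (\<forall>x\<in>S. g x = x)" if "g \<in> extensional S" for g :: "'a \<Rightarrow> 'a"
  proof
    assume "\<forall>x\<in>S. g x = x"
    then show "g = (\<lambda>x\<in>S. x)"
      by (intro extensionalityI[OF that restrict_extensional]) simp
  qed simp
  ultimately have "f [^]\<^bsub>BijGroup S\<^esub> n = \<one>\<^bsub>BijGroup S\<^esub> \<longleftrightarrow>
      (\<forall>x\<in>S. (f [^]\<^bsub>BijGroup S\<^esub> n) x = x)"
    unfolding one by blast
  then show ?thesis
    by (simp only: nat_pow_BijGroup[OF assms] cong: ball_cong)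
qed

text \<open>By \<open>id\<close>, the order divides the orbit length; conversely, as many iterates
  of \<open>x\<close> as the order already exhaust the orbit.\<close>

lemma regular_cycleI:
  assumes f: "f \<in> Bij S" "finite S" and x: "x \<in> S"
    and id: "\<forall>y\<in>S. (f ^^ card (orbit f x)) y = y"
  shows "regular_cycle S f (orbit f x)"
proof -
  interpret B: group "BijGroup S" by (rule group_BijGroup)
  let ?n = "B.ord f"
  have fB: "f \<in> carrier (BijGroup S)" using f by (simp add: BijGroup_def)
  have self: "x \<in> orbit f x"
    using f x by (intro self_in_orbit_bij_betw) (auto simp: Bij_def)
  have pos: "card (orbit f x) > 0"
    using finite_orbit[OF self] self by (auto simp: card_gt_0_iff)
  have dvd: "?n dvd card (orbit f x)"
    using id fB by (simp flip: B.pow_eq_id add: nat_pow_BijGroup_eq_one_iff[OF f(1)])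
  \<comment> \<open>Infinite order is encoded as 0, which divides no positive number.\<close>
  then have npos: "?n > 0" using pos by (cases "?n = 0") auto
  have "(f ^^ ?n) x = x"
    using B.pow_ord_eq_1[OF fB] x by (simp add: nat_pow_BijGroup_eq_one_iff[OF f(1)])
  from orbit_altdef_bounded[OF this npos]
  have "orbit f x = (\<lambda>m. (f ^^ m) x) ` {..<?n}" by auto
  then have "card (orbit f x) \<le> ?n"
    using card_image_le[of "{..<?n}" "\<lambda>m. (f ^^ m) x"] by simp
  moreover have "?n \<le> card (orbit f x)" using dvd pos by (rule dvd_imp_le)
  ultimately show ?thesis
    using x by (simp add: regular_cycle_def cycles_on_def)
qed

section \<open>Iterates of automorphisms and their fixed points\<close>

context group
begin

lemma inv_mult_cancel_left:
  assumes "x \<in> carrier G" "y \<in> carrier G"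
  shows "inv x \<otimes> (x \<otimes> y) = y" and "x \<otimes> (inv x \<otimes> y) = y"
  using assms by (simp_all flip: m_assoc)

text \<open>Membership in \<open>auto G\<close> would be too strong a claim: iterates need not be
  extensional, for instance when \<open>n = 0\<close>.\<close>

lemma funpow_auto:
  assumes "\<alpha> \<in> auto G"
  shows "(\<alpha> ^^ n) \<in> hom G G" and "inj_on (\<alpha> ^^ n) (carrier G)"
proof -
  have a: "\<alpha> \<in> hom G G" "inj_on \<alpha> (carrier G)" "\<alpha> ` carrier G = carrier G"
    using assms by (auto simp: auto_def Bij_def bij_betw_def)
  show "(\<alpha> ^^ n) \<in> hom G G"
  proof (induction n)
    case 0
    then show ?case by (simp add: hom_def)
  next
    case (Suc n)
    show ?case
      unfolding funpow.simps using Suc.IH a(1) by (rule Group.hom_compose)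
  qed
  show "inj_on (\<alpha> ^^ n) (carrier G)"
  proof (induction n)
    case (Suc n)
    then show ?case
      unfolding funpow_Suc_right using a comp_inj_on[of \<alpha> "carrier G" "\<alpha> ^^ n"] by metis
  qed simp
qed

lemma subgroup_fixed_points:
  assumes "\<beta> \<in> hom G G"
  shows "subgroup {x \<in> carrier G. \<beta> x = x} G"
proof -
  interpret \<beta>: group_hom G G \<beta> using assms by unfold_locales
  have "\<one> \<in> {x \<in> carrier G. \<beta> x = x}" by simp
  then show ?thesis by (intro subgroupI) (blast, blast, simp_all)
qed

section \<open>Counting in subgroups\<close>

lemma card_proper_subgroup_le:
  assumes "finite (carrier G)" "subgroup H G" "H \<noteq> carrier G"
  shows "2 * card H \<le> order G"
proof -
  have sub: "H \<subseteq> carrier G" using assms by (simp add: subgroup.subset)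
  have l: "card (rcosets H) * card H = order G" using lagrange[OF assms(2)] .
  have "card H < order G"
    using assms sub by (simp add: order_def psubset_card_mono psubset_eq)
  then have "card (rcosets H) \<noteq> 1" "card (rcosets H) \<noteq> 0"
    using l by (cases "card (rcosets H) = 0"; auto)+
  then have "2 \<le> card (rcosets H)" by linarith
  then show ?thesis using l mult_le_mono1 by metis
qed

text \<open>Otherwise \<open>H\<close> and its left cosets by \<open>a\<close> and \<open>b\<close>
  would be pairwise disjoint and exceed \<open>G\<close> in size. This is index at most 2, phrased
  for elements.\<close>

lemma inv_mult_mem_large_subgroup:
  assumes fin: "finite (carrier G)" and H: "subgroup H G" "order G < 3 * card H"
    and ab: "a \<in> carrier G - H" "b \<in> carrier G - H"
  shows "inv a \<otimes> b \<in> H"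
proof (rule ccontr)
  assume neg: "inv a \<otimes> b \<notin> H"
  interpret H: subgroup H G by (rule H)
  have card_coset: "card ((\<lambda>h. c \<otimes> h) ` H) = card H" if "c \<in> carrier G" for c
    using that by (intro card_image inj_onI) (metis H.mem_carrier inv_mult_cancel_left(1))
  have notin: "c \<otimes> h \<notin> H" if "c \<in> carrier G - H" "h \<in> H" for c h
  proof
    assume "c \<otimes> h \<in> H"
    then have "(c \<otimes> h) \<otimes> inv h \<in> H" using that by simp
    then show False using that by (simp add: m_assoc)
  qed
  have ne: "a \<otimes> h \<noteq> b \<otimes> k" if "h \<in> H" "k \<in> H" for h k
  proof
    assume eq: "a \<otimes> h = b \<otimes> k"
    have "inv a \<otimes> b = inv a \<otimes> (b \<otimes> k) \<otimes> inv k"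
      using ab that by (simp add: m_assoc)
    also have "\<dots> = h \<otimes> inv k" using ab that by (simp add: inv_mult_cancel_left flip: eq)
    finally show False using neg that by simp
  qed
  have finH: "finite H" using fin H.subset by (rule rev_finite_subset)
  have "H \<inter> (\<lambda>h. a \<otimes> h) ` H = {}"
    using notin[OF ab(1)] by blast
  moreover have "(H \<union> (\<lambda>h. a \<otimes> h) ` H) \<inter> (\<lambda>h. b \<otimes> h) ` H = {}"
    using notin[OF ab(2)] ne by blast
  ultimately have "card (H \<union> (\<lambda>h. a \<otimes> h) ` H \<union> (\<lambda>h. b \<otimes> h) ` H) = 3 * card H"
    using finH ab by (simp add: card_Un_disjoint card_coset)
  moreover have "H \<union> (\<lambda>h. a \<otimes> h) ` H \<union> (\<lambda>h. b \<otimes> h) ` H \<subseteq> carrier G"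
    using ab by auto
  then have "card (H \<union> (\<lambda>h. a \<otimes> h) ` H \<union> (\<lambda>h. b \<otimes> h) ` H) \<le> order G"
    unfolding order_def by (rule card_mono[OF fin])
  ultimately show False using H by simp
qed

text \<open>\<open>C\<close> and its translate by \<open>x\<close> each fill more than half of
  \<open>H\<close>, so they meet.\<close>

lemma mem_mult_inv_large_subset:
  assumes fin: "finite H" and H: "subgroup H G"
    and C: "C \<subseteq> H" "card H < 2 * card C" and x: "x \<in> H"
  shows "\<exists>c\<in>C. \<exists>d\<in>C. x = c \<otimes> inv d"
proof -
  interpret H: subgroup H G by (rule H)
  have "card ((\<lambda>c. x \<otimes> c) ` C) = card C"
    using x C by (intro card_image inj_onI) (metis H.mem_carrier inv_mult_cancel_left(1) subsetD)
  moreover have "card (C \<union> (\<lambda>c. x \<otimes> c) ` C) \<le> card H"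
    using C x by (intro card_mono[OF fin]) auto
  moreover have "finite C" using C fin finite_subset by blast
  ultimately have "C \<inter> (\<lambda>c. x \<otimes> c) ` C \<noteq> {}"
    using C(2) card_Un_disjoint[of C "(\<lambda>c. x \<otimes> c) ` C"] by auto
  then obtain c d where cd: "c \<in> C" "d \<in> C" "c = x \<otimes> d" by auto
  then have "x = c \<otimes> inv d" using x C by (auto simp: m_assoc)
  then show ?thesis using cd by blast
qed

section \<open>Automorphisms with a large orbit\<close>

lemma fixed_points_index_two:
  fixes \<beta>
  defines "H \<equiv> {x \<in> carrier G. \<beta> x = x}"
  assumes \<alpha>: "\<alpha> \<in> hom G G" and \<beta>: "\<beta> \<in> hom G G" "inj_on \<beta> (carrier G)"
    and comm: "\<And>x. x \<in> carrier G \<Longrightarrow> \<beta> (\<alpha> x) = \<alpha> (\<beta> x)"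
    and inj: "inj_on \<alpha> (carrier G)"
    and ind: "\<And>a b. a \<in> carrier G - H \<Longrightarrow> b \<in> carrier G - H \<Longrightarrow> inv a \<otimes> b \<in> H"
    and y: "y \<in> carrier G - H"
  defines "u \<equiv> inv y \<otimes> \<beta> y"
  shows "u \<in> H" and "\<And>z. z \<in> H \<Longrightarrow> z \<otimes> u = u \<otimes> z" and "\<alpha> u = u"
proof -
  interpret \<alpha>: group_hom G G \<alpha> using \<alpha> by unfold_locales
  interpret \<beta>: group_hom G G \<beta> using \<beta>(1) by unfold_locales
  interpret H: subgroup H G unfolding H_def by (rule subgroup_fixed_points[OF \<beta>(1)])
  have yc: "y \<in> carrier G" using y by simp
  have fixed: "\<beta> z = z" if "z \<in> H" for z using that by (simp only: H_def mem_Collect_eq)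
  have notin_inv: "inv x \<in> carrier G - H" if "x \<in> carrier G - H" for x
    using that by (metis Diff_iff H.m_inv_closed inv_closed inv_inv)
  \<comment> \<open>If \<open>\<beta>\<close> fixed \<open>\<beta> y\<close>, injectivity would make
    it fix \<open>y\<close>.\<close>
  have "\<beta> y \<in> carrier G - H"
    using y fixed inj_onD[OF \<beta>(2), of "\<beta> y" y] by (metis Diff_iff \<beta>.hom_closed)
  then show uH: "u \<in> H" unfolding u_def by (rule ind[OF y])
  then have uc: "u \<in> carrier G" by (rule H.mem_carrier)
  have \<beta>y: "\<beta> y = y \<otimes> u" using yc by (simp add: u_def inv_mult_cancel_left)
  show uz: "z \<otimes> u = u \<otimes> z" if z: "z \<in> H" for z
  proof -
    have zc: "z \<in> carrier G" using z by (rule H.mem_carrier)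
    have "y \<otimes> z \<notin> H"
    proof
      assume "y \<otimes> z \<in> H"
      then have "(y \<otimes> z) \<otimes> inv z \<in> H" using z by blast
      then show False using y zc by (simp add: m_assoc)
    qed
    then have "y \<otimes> z \<in> carrier G - H" using yc zc by simp
    \<comment> \<open>Applying \<open>ind\<close> to inverses shows that conjugation by
      \<open>y\<close> keeps \<open>z\<close> in \<open>H\<close>.\<close>
    from ind[OF notin_inv[OF this] notin_inv[OF y]]
    have w: "y \<otimes> z \<otimes> inv y \<in> H" using yc zc by simp
    \<comment> \<open>Two factorizations of \<open>y \<otimes> z\<close> are compared under
      \<open>\<beta>\<close>: in one the left factor lies in \<open>H\<close>, in the other the
      right factor \<open>z\<close> does.\<close>
    have "y \<otimes> z = y \<otimes> z \<otimes> inv y \<otimes> y"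
      using yc zc by (simp add: m_assoc)
    then have "\<beta> (y \<otimes> z) = \<beta> (y \<otimes> z \<otimes> inv y \<otimes> y)"
      by (rule arg_cong)
    also have "\<dots> = \<beta> (y \<otimes> z \<otimes> inv y) \<otimes> \<beta> y"
      using w[THEN H.mem_carrier] yc by (rule \<beta>.hom_mult)
    also have "\<dots> = y \<otimes> z \<otimes> inv y \<otimes> (y \<otimes> u)"
      by (simp only: fixed[OF w] \<beta>y)
    also have "\<dots> = y \<otimes> (z \<otimes> u)"
      using yc zc uc by (simp add: m_assoc inv_mult_cancel_left)
    finally have "y \<otimes> (z \<otimes> u) = \<beta> (y \<otimes> z)" ..
    also have "\<dots> = y \<otimes> (u \<otimes> z)" using yc zc uc by (simp add: \<beta>y fixed[OF z] m_assoc)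
    finally show ?thesis using yc zc uc by simp
  qed
  have "\<alpha> y \<in> carrier G - H"
  proof -
    have "\<alpha> (\<beta> y) \<noteq> \<alpha> y"
      using y inj_onD[OF inj, of "\<beta> y" y] \<beta>.hom_closed[OF yc]
      unfolding H_def by blast
    then show ?thesis using yc comm[OF yc] fixed \<alpha>.hom_closed[OF yc] by auto
  qed
  define h where "h = inv y \<otimes> \<alpha> y"
  have hH: "h \<in> H" unfolding h_def by (rule ind) fact+
  then have hc: "h \<in> carrier G" by (rule H.mem_carrier)
  have \<alpha>y: "\<alpha> y = y \<otimes> h" using yc by (simp add: h_def inv_mult_cancel_left)
  \<comment> \<open>Both orders of applying \<open>\<alpha>\<close> and \<open>\<beta>\<close> to
    \<open>y\<close> agree; \<open>\<beta>\<close> fixes \<open>h\<close>, and \<open>u\<close>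
    commutes with \<open>h\<close>.\<close>
  have "y \<otimes> (u \<otimes> h) = \<beta> (\<alpha> y)"
    using yc hc uc by (simp add: \<alpha>y \<beta>y fixed[OF hH] m_assoc)
  also have "\<dots> = \<alpha> (\<beta> y)" using comm yc .
  also have "\<dots> = y \<otimes> (h \<otimes> \<alpha> u)" using yc hc uc by (simp add: \<alpha>y \<beta>y m_assoc)
  finally have "u \<otimes> h = h \<otimes> \<alpha> u" using yc hc uc by simp
  then have "h \<otimes> u = h \<otimes> \<alpha> u" by (simp only: uz[OF hH])
  then show "\<alpha> u = u" using hc uc by simp
qed

text \<open>Right multiplication by \<open>u\<close> commutes with \<open>\<alpha>\<close>, so it
  maps the orbit of \<open>g\<close> onto an orbit in \<open>H\<close> of equal size, which for lack
  of room meets the first. Hence some iterate of \<open>\<alpha>\<close> sends \<open>g\<close> to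
  \<open>g \<otimes> u\<close>.\<close>

lemma fixed_eq_one_of_large_orbit:
  assumes aut: "\<alpha> \<in> auto G" and fin: "finite (carrier G)"
    and H: "subgroup H G" and g: "g \<in> carrier G"
    and C: "orbit \<alpha> g \<subseteq> H" "card H < 2 * card (orbit \<alpha> g)"
    and u: "u \<in> H" "\<alpha> u = u"
  shows "u = \<one>"
proof -
  let ?C = "orbit \<alpha> g"
  interpret H: subgroup H G by (rule H)
  interpret \<alpha>: group_hom G G \<alpha> using aut by unfold_locales (simp add: auto_def)
  have finH: "finite H" using fin H.subset by (rule rev_finite_subset)
  have self: "g \<in> ?C"
    using aut fin g by (intro self_in_orbit_bij_betw) (auto simp: auto_def Bij_def)
  have CG: "c \<in> carrier G" if "c \<in> ?C" for c using that C H.subset by blast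
  have uc: "u \<in> carrier G" using u(1) by (rule H.mem_carrier)
  have gH: "g \<in> H" using self C by blast
  have shift: "(\<lambda>c. c \<otimes> u) ` ?C = orbit \<alpha> (g \<otimes> u)"
    by (rule orbit_inverse[OF self]) (simp add: CG uc u(2))
  have "card ((\<lambda>c. c \<otimes> u) ` ?C) = card ?C"
    by (intro card_image inj_onI) (metis CG uc right_cancel)
  moreover have "card (?C \<union> (\<lambda>c. c \<otimes> u) ` ?C) \<le> card H"
    using C(1) u(1) by (intro card_mono[OF finH]) auto
  ultimately have "?C \<inter> (\<lambda>c. c \<otimes> u) ` ?C \<noteq> {}"
    using C(2) finite_orbit[OF self] card_Un_disjoint[of ?C "(\<lambda>c. c \<otimes> u) ` ?C"] by auto
  then obtain d where d: "d \<in> ?C" "d \<in> orbit \<alpha> (g \<otimes> u)" unfolding shift by blast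
  have "g \<otimes> u \<in> orbit \<alpha> (g \<otimes> u)"
    using aut fin g uc by (intro self_in_orbit_bij_betw) (auto simp: auto_def Bij_def)
  then have "g \<otimes> u \<in> ?C" using d by (meson orbit_swap orbit_trans)
  then obtain k where k: "(\<alpha> ^^ k) g = g \<otimes> u" by (auto simp: orbit_altdef)
  interpret \<gamma>: group_hom G G "\<alpha> ^^ k" using funpow_auto[OF aut] by unfold_locales
  \<comment> \<open>The relation at \<open>g\<close> propagates along the orbit because
    \<open>\<alpha>\<close> commutes with its iterate and fixes \<open>u\<close>.\<close>
  have on_C: "(\<alpha> ^^ k) c = c \<otimes> u" if "c \<in> ?C" for c
    using that
  proof induction
    case base
    then show ?case using g uc by (simp add: k u(2) flip: funpow_swap1)
  next
    case (step c)
    then show ?case using uc by (simp add: CG u(2) flip: funpow_swap1)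
  qed
  \<comment> \<open>In a quotient of two orbit elements the factors \<open>u\<close> cancel, so the
    iterate fixes \<open>g\<close>.\<close>
  obtain c d where cd: "c \<in> ?C" "d \<in> ?C" "g = c \<otimes> inv d"
    using mem_mult_inv_large_subset[OF finH H C gH] by blast
  have cdc: "c \<in> carrier G" "d \<in> carrier G" using cd CG by auto
  have "(\<alpha> ^^ k) g = (c \<otimes> u) \<otimes> inv (d \<otimes> u)"
    unfolding cd(3) using cdc on_C cd(1,2) by simp
  also have "\<dots> = g"
    unfolding cd(3) using cdc uc by (simp add: inv_mult_group m_assoc inv_mult_cancel_left)
  finally show ?thesis using k g uc by simp
qed

lemma funpow_card_large_orbit_eq_id:
  assumes aut: "\<alpha> \<in> auto G" and fin: "finite (carrier G)" and g: "g \<in> carrier G"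
    and large: "order G \<le> 3 * card (orbit \<alpha> g)"
    and max: "\<And>x. x \<in> carrier G \<Longrightarrow> card (orbit \<alpha> x) \<le> card (orbit \<alpha> g)"
  shows "\<forall>x\<in>carrier G. (\<alpha> ^^ card (orbit \<alpha> g)) x = x"
proof (rule ccontr)
  let ?C = "orbit \<alpha> g"
  define \<beta> where "\<beta> = \<alpha> ^^ card ?C"
  define H where "H = {x \<in> carrier G. \<beta> x = x}"
  assume "\<not> ?thesis"
  then obtain y where y: "y \<in> carrier G - H" by (auto simp: H_def \<beta>_def)
  have bij: "bij_betw \<alpha> (carrier G) (carrier G)"
    and \<alpha>: "\<alpha> \<in> hom G G" "inj_on \<alpha> (carrier G)"
    using aut by (auto simp: auto_def Bij_def bij_betw_def)
  have \<beta>: "\<beta> \<in> hom G G" "inj_on \<beta> (carrier G)"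
    unfolding \<beta>_def using funpow_auto[OF aut] by auto
  have H: "subgroup H G" unfolding H_def by (rule subgroup_fixed_points[OF \<beta>(1)])
  then interpret H: subgroup H G .
  have finH: "finite H" using fin H.subset by (rule rev_finite_subset)
  have self: "x \<in> orbit \<alpha> x" if "x \<in> carrier G" for x
    using bij fin that by (rule self_in_orbit_bij_betw)
  have comm: "\<beta> (\<alpha> x) = \<alpha> (\<beta> x)" for x by (simp add: \<beta>_def funpow_swap1)
  have \<beta>g: "\<beta> g = g" unfolding \<beta>_def by (rule orbit_conv_funpow_card[OF self[OF g]])
  have CH: "?C \<subseteq> H"
  proof
    fix c assume c: "c \<in> ?C"
    then have "c \<in> carrier G"
      using orbit_subset_funcset[OF bij_betw_imp_funcset[OF bij] g] by blast
    moreover have "\<beta> c = c" using c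
    proof induction
      case base
      then show ?case by (simp only: comm \<beta>g)
    qed (simp only: comm)
    ultimately show "c \<in> H" unfolding H_def by blast
  qed
  have le: "card ?C \<le> card H" using card_mono[OF finH CH] .
  \<comment> \<open>Strictness excludes index 3. Equality would make the orbit all of
    \<open>H\<close>, hence the orbit of \<open>\<one>\<close>, so its length would be 1.\<close>
  have "order G < 3 * card H"
  proof (rule ccontr)
    assume "\<not> ?thesis"
    then have "card ?C = card H" using le large by simp
    then have "?C = H" using card_subset_eq[OF finH CH] by simp
    then have one: "\<one> \<in> ?C" by simp
    have "\<alpha> \<one> = \<one>" using \<alpha>(1) by (simp add: hom_one is_group)
    then have "orbit \<alpha> \<one> = {\<one>}" by (simp add: orbit_eq_singleton_iff)
    moreover have "g \<in> orbit \<alpha> \<one>" using orbit_swap[OF self[OF g] one] .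
    ultimately have "?C = {\<one>}" by simp
    then have L: "card ?C = 1" by simp
    \<comment> \<open>By maximality the cycle of \<open>y\<close> is a single point, yet it contains
      both \<open>y\<close> and \<open>\<alpha> y\<close>.\<close>
    then have "card (orbit \<alpha> y) \<le> 1" using max[of y] y by simp
    moreover have "y \<in> orbit \<alpha> y" using y by (intro self) blast
    ultimately have "\<alpha> y = y"
      using card_le_Suc0_iff_eq[OF finite_orbit] orbit.base[of \<alpha> y] by (metis One_nat_def)
    then have "\<beta> y = y" unfolding \<beta>_def L by simp
    then show False using y unfolding H_def by blast
  qed
  then have ind: "inv a \<otimes> b \<in> H" if "a \<in> carrier G - H" "b \<in> carrier G - H" for a b
    using inv_mult_mem_large_subgroup[OF fin H] that by blast
  have "H \<noteq> carrier G" using y by auto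
  \<comment> \<open>The orbit fills at least two thirds of \<open>H\<close>, as \<open>H\<close> has
    at most half the elements of \<open>G\<close>.\<close>
  from card_proper_subgroup_le[OF fin H this] have "2 * card H \<le> 3 * card ?C"
    using large by linarith
  moreover have "card H > 0" using finH H.one_closed card_gt_0_iff by blast
  ultimately have half: "card H < 2 * card ?C" by linarith
  note u = fixed_points_index_two[OF \<alpha>(1) \<beta> comm \<alpha>(2), folded H_def, OF ind y]
  have "inv y \<otimes> \<beta> y = \<one>"
    using fixed_eq_one_of_large_orbit[OF aut fin H g CH half u(1,3)] .
  then have "\<beta> y = y"
    using y inv_mult_cancel_left(2)[of y "\<beta> y"] hom_in_carrier[OF \<beta>(1), of y] by simp
  then show False using y unfolding H_def by blast
qed

end

theorem theorem3p11:
  fixes G :: "('a, 'b) monoid_scheme" and \<alpha> :: "'a \<Rightarrow> 'a"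
  assumes "group G"
    and "finite (carrier G)"
    and "\<alpha> \<in> auto G"
    and "cycle_ratio G \<alpha> \<ge> 1 / 3"
  shows "\<exists>C. regular_cycle (carrier G) \<alpha> C"
proof -
  interpret group G by (rule assms)
  let ?cards = "card ` cycles_on (carrier G) \<alpha>"
  have fin: "finite ?cards" using assms(2) by (simp add: cycles_on_def)
  have "?cards \<noteq> {}" by (auto simp: cycles_on_def)
  from Max_in[OF fin this] obtain g
    where g: "g \<in> carrier G" "largest_cycle_length (carrier G) \<alpha> = card (orbit \<alpha> g)"
    by (auto simp: cycles_on_def largest_cycle_length_def)
  have max: "card (orbit \<alpha> x) \<le> card (orbit \<alpha> g)" if "x \<in> carrier G" for x
    using that Max_ge[OF fin] by (simp add: cycles_on_def flip: g(2) add: largest_cycle_length_def)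
  have "order G > 0" using assms(2) by (simp add: order_gt_0_iff_finite)
  \<comment> \<open>Clearing the positive denominator turns the ratio bound into an inequality
    between natural numbers.\<close>
  then have "real (order G) \<le> real (3 * card (orbit \<alpha> g))"
    using assms(4) by (simp add: cycle_ratio_def g(2) field_simps)
  then have "order G \<le> 3 * card (orbit \<alpha> g)" by linarith
  from funpow_card_large_orbit_eq_id[OF assms(3,2) g(1) this max]
  have "regular_cycle (carrier G) \<alpha> (orbit \<alpha> g)"
    using assms(2,3) g(1) by (intro regular_cycleI) (auto simp: auto_def)
  then show ?thesis ..
qed

end
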